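(* For $\mathbf{t}, \mathbf{k}\in \mathbb{N}_0^{(\infty)}$ and $\boldsymbol{\lambda}\in\Lambda^{\mathrm{dep}(\mathbf{t})}$, $\boldsymbol{\mu}\in\Lambda^{\mathrm{dep}(\mathbf{k})}$, we have $$ \langle \mathsf{S}^{(\mathbf{t},\boldsymbol{\lambda})},\mathsf{M}^{(\mathbf{k},\boldsymbol{\mu})}\rangle=\delta_{(\mathbf{t},\boldsymbol{\lambda})}^{(\mathbf{k},\boldsymbol{\mu})}, $$ where the Kronecker symbol is $1$ if the pairs $(\mathbf{t},\boldsymbol{\lambda})$ and $(\mathbf{k},\boldsymbol{\mu})$ coincide and $0$ otherwise.
   Context: Let $R$ be a commutative integral domain of characteristic 0, $\Lambda$ a nonempty index set, and $R\langle X,Y_\lambda\rangle_{\lambda\in\Lambda}$ the free associative algebra over $R$ on letters $X,Y_\lambda$. Set $Y_\lambda^{(0)}=Y_\lambda$, $Y_\lambda^{(k+1)}=[X,Y_\lambda^{(k)}]$. Let $\mathbb{N}_0^{(\infty)}$ be the set of sequences $\mathbf{k}=(k_1,\dots,k_d;k_\infty)$ of non-negative integers ($d\ge0$), with depth $\mathrm{dep}(\mathbf{k})=d$. For $\boldsymbol{\lambda}=(\lambda_1,\dots,\lambda_d)\in\Lambda^d$, define $\mathsf{M}^{(\mathbf{k},\boldsymbol{\lambda})}=Y_{\lambda_1}^{(k_1)}\cdots Y_{\lambda_d}^{(k_d)}X^{k_\infty}$, $\mathsf{S}^{(\mathbf{k},\boldsymbol{\lambda})}=(\cdots((X^{k_1}Y_{\lambda_1})\,\text{ш}\,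 X^{k_2})Y_{\lambda_2})\,\text{ш}\cdots\text{ш}\, X^{k_d})Y_{\lambda_d})\,\text{ш}\, X^{k_\infty}$ (ш the shuffle product), and words $w_{\mathbf{k},\boldsymbol{\lambda}}=X^{k_1}Y_{\lambda_1}\cdots X^{k_d}Y_{\lambda_d}X^{k_\infty}$; for $d=0$ all three equal $X^k$. The pairing $\langle\ ,\ \rangle$ is the standard one for which the words $w_{\mathbf{k},\boldsymbol{\lambda}}$ form an orthonormal basis. *)

theory Defs
  imports "HOL-Library.Poly_Mapping"
begin

(* The index set Lambda is the type 'l; types are nonempty in HOL. *)
datatype 'l letter = X | Y 'l

(* The free monoid: Poly_Mapping forms the monoid algebra of an additively written monoid. *)
instantiation list :: (type) monoid_add
begin
definition zero_list :: "'a list" where "zero_list = []"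
definition plus_list :: "'a list \<Rightarrow> 'a list \<Rightarrow> 'a list" where "plus_list = (@)"
instance by standard (simp_all add: zero_list_def plus_list_def)
end

(* R<X, Y_l>: finitely supported functions from words to R with the convolution product,
   which by the instance above is the bilinear extension of concatenation. *)
type_synonym ('l, 'r) free_alg = "'l letter list \<Rightarrow>\<^sub>0 'r"

definition word :: "'l letter list \<Rightarrow> ('l, 'r::comm_ring_1) free_alg" where
  "word w = Poly_Mapping.single w 1"

definition scale :: "'r \<Rightarrow> ('l, 'r::comm_ring_1) free_alg \<Rightarrow> ('l, 'r) free_alg" where
  "scale c f = Poly_Mapping.single [] c * f"

definition genX :: "('l, 'r::comm_ring_1) free_alg" where
  "genX = word [X]"

definition genY :: "'l \<Rightarrow> ('l, 'r::comm_ring_1) free_alg" where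
  "genY l = word [Y l]"

definition commutator :: "'a::ring \<Rightarrow> 'a \<Rightarrow> 'a" where
  "commutator a b = a * b - b * a"

definition adY :: "nat \<Rightarrow> 'l \<Rightarrow> ('l, 'r::comm_ring_1) free_alg" where
  "adY k l = (commutator genX ^^ k) (genY l)"

(* Unlike List.shuffles, which is a set, this keeps multiplicities. *)
fun shuffle_words :: "'l letter list \<Rightarrow> 'l letter list \<Rightarrow> ('l, 'r::comm_ring_1) free_alg" where
  "shuffle_words [] v = word v"
| "shuffle_words u [] = word u"
| "shuffle_words (a # u) (b # v) =
     word [a] * shuffle_words u (b # v) + word [b] * shuffle_words (a # u) v"

definition shuffle ::
  "('l, 'r::comm_ring_1) free_alg \<Rightarrow> ('l, 'r) free_alg \<Rightarrow> ('l, 'r) free_alg" where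
  "shuffle f g = (\<Sum>u\<in>Poly_Mapping.keys f. \<Sum>v\<in>Poly_Mapping.keys g.
     scale (Poly_Mapping.lookup f u * Poly_Mapping.lookup g v) (shuffle_words u v))"

definition pairing :: "('l, 'r::comm_ring_1) free_alg \<Rightarrow> ('l, 'r) free_alg \<Rightarrow> 'r" where
  "pairing f g = (\<Sum>w\<in>Poly_Mapping.keys f. Poly_Mapping.lookup f w * Poly_Mapping.lookup g w)"

(* (k_1, ..., k_d; k_inf) is encoded as ([k_1, ..., k_d], k_inf). *)
type_synonym mindex = "nat list \<times> nat"

definition dep :: "mindex \<Rightarrow> nat" where
  "dep k = length (fst k)"

(* In the following, the list of elements of Lambda is meant to have length dep k;
   zip silently truncates otherwise. *)

definition Mpoly :: "mindex \<Rightarrow> 'l list \<Rightarrow> ('l, 'r::comm_ring_1) free_alg" where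
  "Mpoly k ls = prod_list (map (\<lambda>(k, l). adY k l) (zip (fst k) ls)) * genX ^ snd k"

definition Spoly :: "mindex \<Rightarrow> 'l list \<Rightarrow> ('l, 'r::comm_ring_1) free_alg" where
  "Spoly k ls = (case zip (fst k) ls of
       [] \<Rightarrow> genX ^ snd k
     | (k\<^sub>1, l\<^sub>1) # ps \<Rightarrow>
         shuffle (foldl (\<lambda>A (k, l). shuffle A (genX ^ k) * genY l) (genX ^ k\<^sub>1 * genY l\<^sub>1) ps)
           (genX ^ snd k))"

definition w_word :: "mindex \<Rightarrow> 'l list \<Rightarrow> 'l letter list" where
  "w_word k ls =
     concat (map (\<lambda>(k, l). replicate k X @ [Y l]) (zip (fst k) ls)) @ replicate (snd k) X"

(* The pairing is the one for which the words w_word k ls, i.e. all words, are orthonormal. *)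

lemma pairing_word: "pairing (word u) (word v :: ('l, 'r::comm_ring_1) free_alg) = of_bool (u = v)"
  by (simp add: pairing_def word_def lookup_single when_def)

lemma w_word_simps:
  "w_word ([], Suc n) [] = X # w_word ([], n) []"
  "w_word (Suc k # ks, n) (l # ls) = X # w_word (k # ks, n) (l # ls)"
  "w_word (0 # ks, n) (l # ls) = Y l # w_word (ks, n) ls"
  "w_word ([], 0) [] = []"
  by (simp_all add: w_word_def)

fun parse_word :: "'l letter list \<Rightarrow> mindex \<times> 'l list" where
  "parse_word [] = (([], 0), [])"
| "parse_word (Y l # w) = (case parse_word w of ((ks, n), ls) \<Rightarrow> ((0 # ks, n), l # ls))"
| "parse_word (X # w) = (case parse_word w of
      (([], n), ls) \<Rightarrow> (([], Suc n), ls)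
    | ((k # ks, n), ls) \<Rightarrow> ((Suc k # ks, n), ls))"

lemma parse_w_word: "length ls = length ks \<Longrightarrow> parse_word (w_word (ks, n) ls) = ((ks, n), ls)"
proof (induction ls ks rule: list_induct2)
  case Nil
  show ?case by (induction n) (simp_all add: w_word_simps)
next
  case (Cons l ls k ks)
  then show ?case by (induction k) (simp_all add: w_word_simps)
qed

lemma w_word_parse:
  "parse_word w = ((ks, n), ls) \<Longrightarrow> length ls = length ks \<and> w_word (ks, n) ls = w"
proof (induction w arbitrary: ks n ls rule: parse_word.induct)
  case (3 w)
  obtain ks' n' ls' where p: "parse_word w = ((ks', n'), ls')" by (metis prod.exhaust)
  with 3 show ?case by (cases ks'; cases ls') (auto simp: w_word_simps)
qed (auto simp: w_word_simps split: prod.splits)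

lemma bij_betw_w_word:
  "bij_betw (\<lambda>(k, ls :: 'l list). w_word k ls) {(k, ls). length ls = dep k} UNIV"
proof (rule bij_betw_byWitness[where f' = parse_word])
  have "case parse_word w of (k, ls) \<Rightarrow> length ls = dep k \<and> w_word k ls = w" for w :: "'l letter list"
    using w_word_parse[of w] by (cases "parse_word w") (auto simp: dep_def)
  then show "parse_word ` UNIV \<subseteq> {(k, ls :: 'l list). length ls = dep k}"
    and "\<forall>w\<in>UNIV. (\<lambda>(k, ls :: 'l list). w_word k ls) (parse_word w) = w"
    by (simp_all add: case_prod_beta image_subset_iff)
qed (auto simp: dep_def parse_w_word)

end

theory Submission
  imports Defs
begin

text \<open>
  Shuffling with \<open>X\<^sup>n\<close> on the left of the pairing is adjoint to a divided power of the derivation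
  with \<open>X \<mapsto> 1\<close>, \<open>Y \<mapsto> 0\<close>. All \<open>Y\<^sup>(\<^sup>k\<^sup>)\<close> are killed by this derivation, hence so
  are their products, and if no word of \<open>f\<close> ends in \<open>X\<close>, the pairing of the shuffle of \<open>f\<close> and
  \<open>X\<^sup>n\<close> with \<open>P X\<^sup>m\<close> is \<open>\<delta>\<close> of \<open>(m, n)\<close> times the pairing of \<open>f\<close> with \<open>P\<close>.
  The only word of \<open>Y\<^sup>(\<^sup>k\<^sup>)\<close> not ending in \<open>X\<close> is \<open>X\<^sup>k Y\<close>, so pairing \<open>A Y\<close> with
  \<open>P Y\<^sup>(\<^sup>k\<^sup>)\<close> amounts to pairing \<open>A\<close> with \<open>P X\<^sup>k\<close>, which gives a recursion on the depth.
\<close>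

section \<open>Linear extension of functions on words\<close>

text \<open>This extends the right slot of \<open>pairing\<close> to arbitrary functions on words in
  the left slot, including those of infinite support.\<close>

definition lin_ext :: "('a \<Rightarrow> 'r) \<Rightarrow> ('a \<Rightarrow>\<^sub>0 'r::comm_ring_1) \<Rightarrow> 'r" where
  "lin_ext F g = (\<Sum>w\<in>Poly_Mapping.keys g. Poly_Mapping.lookup g w * F w)"

lemma lin_ext_superset:
  assumes "finite A" "Poly_Mapping.keys g \<subseteq> A"
  shows "lin_ext F g = (\<Sum>w\<in>A. Poly_Mapping.lookup g w * F w)"
  unfolding lin_ext_def using assms
  by (intro sum.mono_neutral_left) (auto simp: in_keys_iff)

lemma lin_ext_single [simp]: "lin_ext F (Poly_Mapping.single w c) = c * F w"
  by (subst lin_ext_superset[of "{w}"]) (auto simp: lookup_single)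

lemma lin_ext_add: "lin_ext F (g + h) = lin_ext F g + lin_ext F h"
proof -
  let ?A = "Poly_Mapping.keys g \<union> Poly_Mapping.keys h"
  have "lin_ext F (g + h) = (\<Sum>w\<in>?A. Poly_Mapping.lookup (g + h) w * F w)"
    by (rule lin_ext_superset) (auto simp: Poly_Mapping.keys_add)
  also have "\<dots> = (\<Sum>w\<in>?A. Poly_Mapping.lookup g w * F w)
      + (\<Sum>w\<in>?A. Poly_Mapping.lookup h w * F w)"
    by (simp add: lookup_add distrib_right sum.distrib)
  also have "\<dots> = lin_ext F g + lin_ext F h"
    by (simp add: lin_ext_superset[of ?A])
  finally show ?thesis .
qed

lemma lin_ext_diff: "lin_ext F (g - h) = lin_ext F g - lin_ext F h"
  using lin_ext_add[of F "g - h" h] by (simp add: algebra_simps)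

lemma lin_ext_fun_zero [simp]: "lin_ext (\<lambda>w. 0) g = 0"
  by (simp add: lin_ext_def)

lemma lin_ext_fun_add: "lin_ext (\<lambda>w. F w + G w) g = lin_ext F g + lin_ext G g"
  by (simp add: lin_ext_def algebra_simps sum.distrib)

lemma lin_ext_fun_mult: "lin_ext (\<lambda>w. c * F w) g = c * lin_ext F g"
  by (simp add: lin_ext_def sum_distrib_left algebra_simps)

lemma lin_ext_swap:
  "lin_ext (\<lambda>u. lin_ext (\<lambda>v. F u v) h) g = lin_ext (\<lambda>v. lin_ext (\<lambda>u. F u v) g) h"
  unfolding lin_ext_def sum_distrib_left
  by (subst sum.swap) (simp add: algebra_simps)

lemma poly_mapping_single_add_induct [case_names zero single_add]:
  fixes g :: "'a \<Rightarrow>\<^sub>0 'r::comm_ring_1"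
  assumes "P 0" and "\<And>w c g. P g \<Longrightarrow> P (Poly_Mapping.single w c + g)"
  shows "P g"
proof (induction g rule: Poly_Mapping.update_induct)
  case const
  show ?case by (rule assms(1))
next
  case (update f w c)
  have "Poly_Mapping.update w c f = Poly_Mapping.single w c + f"
    using update(1) by (intro poly_mapping_eqI)
      (auto simp: Poly_Mapping.lookup_update lookup_add lookup_single in_keys_iff when_def)
  then show ?case using assms(2) update by simp
qed

lemma lin_ext_zero [simp]: "lin_ext F 0 = 0"
  by (simp add: lin_ext_def)

lemma lin_ext_mult: "lin_ext F (g * h) = lin_ext (\<lambda>u. lin_ext (\<lambda>v. F (u + v)) h) g"
proof (induction g rule: poly_mapping_single_add_induct)
  case (single_add u c g)
  have "lin_ext F (Poly_Mapping.single u c * h) = c * lin_ext (\<lambda>v. F (u + v)) h"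
    by (induction h rule: poly_mapping_single_add_induct)
      (simp_all add: mult_single distrib_left lin_ext_add algebra_simps)
  with single_add show ?case by (simp add: distrib_right lin_ext_add)
qed simp

text \<open>Makes coefficients instances of \<open>lin_ext\<close>, so that those of products follow
  from \<open>lin_ext_mult\<close> without unfolding the convolution.\<close>

lemma lin_ext_lookup: "lin_ext (\<lambda>u. of_bool (u = w)) g = Poly_Mapping.lookup g w"
  by (subst lin_ext_superset[of "insert w (Poly_Mapping.keys g)"])
    (auto simp: of_bool_def if_distrib cong: if_cong)

lemma pairing_lin_ext: "pairing f g = lin_ext (Poly_Mapping.lookup f) g"
proof -
  let ?A = "Poly_Mapping.keys f \<union> Poly_Mapping.keys g"
  have "pairing f g = (\<Sum>w\<in>?A. Poly_Mapping.lookup f w * Poly_Mapping.lookup g w)"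
    unfolding pairing_def by (intro sum.mono_neutral_left) (auto simp: in_keys_iff)
  also have "\<dots> = lin_ext (Poly_Mapping.lookup f) g"
    by (subst lin_ext_superset[of ?A]) (auto simp: mult.commute)
  finally show ?thesis .
qed

lemma lin_ext_word [simp]:
  fixes F :: "'l letter list \<Rightarrow> 'r::comm_ring_1"
  shows "lin_ext F (word w) = F w"
  by (simp add: word_def)

lemma lin_ext_mult_list:
  fixes g h :: "('l, 'r::comm_ring_1) free_alg"
  shows "lin_ext F (g * h) = lin_ext (\<lambda>u. lin_ext (\<lambda>v. F (u @ v)) h) g"
  by (simp add: lin_ext_mult plus_list_def)

lemma word_mult: "word u * word v = word (u @ v)"
  by (simp add: word_def mult_single plus_list_def)

lemma word_Nil: "word [] = 1"
  by (metis word_def zero_list_def single_one)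

lemma genX_power: "genX ^ n = word (replicate n X)"
  by (induction n) (simp_all add: word_Nil genX_def word_mult)

lemma lookup_word: "Poly_Mapping.lookup (word u) w = of_bool (u = w)"
  by (simp add: word_def lookup_single when_def)

lemma lookup_one_list: "Poly_Mapping.lookup (1 :: ('l, 'r::comm_ring_1) free_alg) w = of_bool (w = [])"
  using lookup_word[of "[]" w] by (simp add: word_Nil eq_commute)

lemma lin_ext_one_list [simp]: "lin_ext F (1 :: ('l, 'r::comm_ring_1) free_alg) = F []"
  using lin_ext_word[of F "[]"] by (simp add: word_Nil)

lemma lookup_word_Cons_mult:
  "Poly_Mapping.lookup (word [a] * g) [] = 0"
  "Poly_Mapping.lookup (word [a] * g) (b # w) = of_bool (a = b) * Poly_Mapping.lookup g w"
  by (simp_all flip: lin_ext_lookup add: lin_ext_mult_list lin_ext_fun_mult)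

lemma lookup_mult_genY:
  "Poly_Mapping.lookup (g * genY l) [] = 0"
  "Poly_Mapping.lookup (g * genY l) (w @ [a]) = of_bool (a = Y l) * Poly_Mapping.lookup g w"
  by (auto simp flip: lin_ext_lookup simp add: genY_def lin_ext_mult_list lin_ext_fun_mult)

section \<open>Shuffling with powers of \<open>X\<close>\<close>

text \<open>The coefficients of the shuffle with \<open>X\<^sup>n\<close>, read off letter by letter. It is defined for
  arbitrary functions on words, so that no finiteness of supports has to be maintained.\<close>

fun shuffle_X :: "nat \<Rightarrow> ('l letter list \<Rightarrow> 'r::comm_ring_1) \<Rightarrow> 'l letter list \<Rightarrow> 'r" where
  "shuffle_X 0 F w = F w"
| "shuffle_X (Suc n) F [] = 0"
| "shuffle_X (Suc n) F (X # w) = shuffle_X (Suc n) (\<lambda>v. F (X # v)) w + shuffle_X n F w"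
| "shuffle_X (Suc n) F (Y l # w) = shuffle_X (Suc n) (\<lambda>v. F (Y l # v)) w"

lemma shuffle_X_lin_ext:
  "shuffle_X n (\<lambda>w. lin_ext (\<lambda>u. G u w) f) w = lin_ext (\<lambda>u. shuffle_X n (G u) w) f"
proof -
  \<comment> \<open>\<open>F\<close> is a variable tied to \<open>G\<close> by an equation, because
    \<open>shuffle_X.induct\<close> changes the function at every letter.\<close>
  have "shuffle_X n F w = lin_ext (\<lambda>u. shuffle_X n (G u) w) f"
    if "F = (\<lambda>w. lin_ext (\<lambda>u. G u w) f)" for F
    using that
    by (induction n F w arbitrary: G rule: shuffle_X.induct) (simp_all add: lin_ext_fun_add)
  then show ?thesis by blast
qed

lemma shuffle_X_diff:
  "shuffle_X n (\<lambda>w. F w - G w) w = shuffle_X n F w - shuffle_X n G w"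
proof -
  have "shuffle_X n H w = shuffle_X n F w - shuffle_X n G w" if "H = (\<lambda>w. F w - G w)" for H
    using that by (induction n H w arbitrary: F G rule: shuffle_X.induct) simp_all
  then show ?thesis by blast
qed

lemma shuffle_X_zero [simp]: "shuffle_X n (\<lambda>w. 0) w = 0"
  using shuffle_X_diff[of n "\<lambda>w. 0" "\<lambda>w. 0" w] by simp

lemma shuffle_X_delta_Nil:
  "shuffle_X n (\<lambda>w. of_bool ([] = w)) w = of_bool (replicate n X = w)"
proof (induction n arbitrary: w)
  case (Suc n)
  show ?case
  proof (cases w)
    case (Cons a v)
    then show ?thesis by (cases a) (simp_all add: Suc)
  qed simp
qed simp

text \<open>Either argument of \<open>shuffle_words\<close> may lose its first letter, hence an
  induction on \<open>u\<close> inside one on \<open>n\<close>: the first letter of \<open>w\<close>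
  comes from \<open>u\<close> or, if it is \<open>X\<close>, from the power.\<close>

lemma lookup_shuffle_words_X:
  "Poly_Mapping.lookup (shuffle_words u (replicate n X)) w = shuffle_X n (\<lambda>w. of_bool (u = w)) w"
proof (induction n arbitrary: u w)
  case 0
  show ?case by (cases u) (simp_all add: lookup_word)
next
  case (Suc n)
  show ?case
  proof (induction u arbitrary: w)
    case Nil
    show ?case by (simp only: shuffle_words.simps lookup_word shuffle_X_delta_Nil)
  next
    case (Cons a u)
    have *: "shuffle_X (Suc n) (\<lambda>v. of_bool (a # u = b # v)) w
        = of_bool (a = b) * shuffle_X (Suc n) (\<lambda>v. of_bool (u = v)) w" for b w
      by (cases "a = b") simp_all
    show ?case
    proof (cases w)
      case Nil
      then show ?thesis by (simp add: lookup_add lookup_word_Cons_mult)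
    next
      case w: (Cons b v)
      then show ?thesis
        using Cons Suc[of "a # u"] * by (cases b) (simp_all add: lookup_add lookup_word_Cons_mult)
    qed
  qed
qed

lemma lookup_scale: "Poly_Mapping.lookup (scale c f) w = c * Poly_Mapping.lookup f w"
  by (simp flip: lin_ext_lookup add: scale_def lin_ext_mult_list)

lemma lookup_shuffle_X:
  "Poly_Mapping.lookup (shuffle f (genX ^ n)) w = shuffle_X n (Poly_Mapping.lookup f) w"
proof -
  have "Poly_Mapping.lookup (shuffle f (genX ^ n)) w
      = lin_ext (\<lambda>u. Poly_Mapping.lookup (shuffle_words u (replicate n X)) w) f"
    by (simp add: shuffle_def genX_power word_def lookup_sum lookup_scale lin_ext_def)
  also have "\<dots> = lin_ext (\<lambda>u. shuffle_X n (\<lambda>w. of_bool (u = w)) w) f"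
    by (simp add: lookup_shuffle_words_X)
  also have "\<dots> = shuffle_X n (Poly_Mapping.lookup f) w"
    by (simp flip: shuffle_X_lin_ext add: lin_ext_lookup)
  finally show ?thesis .
qed

lemma shuffle_one_X:
  "shuffle 1 (genX ^ n) = (genX ^ n :: ('l, 'r::comm_ring_1) free_alg)"
proof (rule poly_mapping_eqI)
  fix w
  have "Poly_Mapping.lookup (1 :: ('l, 'r) free_alg) = (\<lambda>w. of_bool ([] = w))"
    by (auto simp: lookup_one_list)
  then show "Poly_Mapping.lookup (shuffle 1 (genX ^ n)) w
      = Poly_Mapping.lookup (genX ^ n :: ('l, 'r) free_alg) w"
    by (simp only: lookup_shuffle_X shuffle_X_delta_Nil) (simp only: genX_power lookup_word)
qed

lemma shuffle_X_vanishing: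
  assumes "\<And>j. F (replicate j X) = 0"
  shows "shuffle_X n F (replicate m X) = 0"
  using assms
proof (induction m arbitrary: n F)
  case 0
  then have "F [] = 0" by (metis replicate_0)
  then show ?case by (cases n) simp_all
next
  case (Suc m)
  have "F (X # replicate j X) = 0" for j
    using Suc.prems[of "Suc j"] by simp
  with Suc show ?case by (cases n) simp_all
qed

text \<open>In general the value at X^m is the binomial coefficient (m over n) times the value of
  \<open>F\<close> at X^(m-n), and 0 if m < n. Here only m = n survives, with coefficient 1.\<close>

lemma shuffle_X_delta:
  assumes "\<And>j. F (replicate (Suc j) X) = 0"
  shows "shuffle_X n F (replicate m X) = of_bool (m = n) * F []"
proof (induction n arbitrary: m)
  case 0
  show ?case using assms by (cases m) simp_all
next
  case (Suc n)
  show ?case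
  proof (cases m)
    case (Suc m')
    have "shuffle_X (Suc n) (\<lambda>v. F (X # v)) (replicate m' X) = 0"
      using assms by (intro shuffle_X_vanishing) simp
    with Suc show ?thesis using Suc.IH by simp
  qed simp
qed

section \<open>Elements commuting with the shuffle by powers of \<open>X\<close>\<close>

text \<open>Says that \<open>A\<close> is killed by the derivation with \<open>X \<mapsto> 1\<close> and \<open>Y \<mapsto> 0\<close> and its
  divided powers, formulated on the dual side.\<close>

definition shuffle_X_invariant :: "('l, 'r::comm_ring_1) free_alg \<Rightarrow> bool" where
  "shuffle_X_invariant A \<longleftrightarrow> (\<forall>n F v.
     lin_ext (\<lambda>u. shuffle_X n F (u @ v)) A = shuffle_X n (\<lambda>v. lin_ext (\<lambda>u. F (u @ v)) A) v)"

lemma shuffle_X_invariant_one: "shuffle_X_invariant 1"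
  by (simp add: shuffle_X_invariant_def)

lemma shuffle_X_invariant_mult:
  assumes "shuffle_X_invariant A" "shuffle_X_invariant B"
  shows "shuffle_X_invariant (A * B)"
  unfolding shuffle_X_invariant_def
proof (intro allI)
  fix n v and F :: "'a letter list \<Rightarrow> 'b"
  have "lin_ext (\<lambda>u. shuffle_X n F (u @ v)) (A * B)
      = lin_ext (\<lambda>u'. lin_ext (\<lambda>u. shuffle_X n F (u @ u' @ v)) A) B"
    by (simp add: lin_ext_mult_list) (rule lin_ext_swap)
  \<comment> \<open>Invariance of \<open>A\<close> is used with tail \<open>u' @ v\<close>, then
    that of \<open>B\<close> with tail \<open>v\<close>.\<close>
  also have "\<dots> = shuffle_X n (\<lambda>v. lin_ext (\<lambda>u'. lin_ext (\<lambda>u. F (u @ u' @ v)) A) B) v"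
    using assms by (simp add: shuffle_X_invariant_def)
  also have "\<dots> = shuffle_X n (\<lambda>v. lin_ext (\<lambda>u. F (u @ v)) (A * B)) v"
    by (subst lin_ext_swap) (simp add: lin_ext_mult_list)
  finally show "lin_ext (\<lambda>u. shuffle_X n F (u @ v)) (A * B)
      = shuffle_X n (\<lambda>v. lin_ext (\<lambda>u. F (u @ v)) (A * B)) v" .
qed

lemma shuffle_X_invariant_genY: "shuffle_X_invariant (genY l)"
  unfolding shuffle_X_invariant_def
proof (intro allI)
  fix n v and F :: "'a letter list \<Rightarrow> 'b"
  show "lin_ext (\<lambda>u. shuffle_X n F (u @ v)) (genY l)
      = shuffle_X n (\<lambda>v. lin_ext (\<lambda>u. F (u @ v)) (genY l)) v"
    by (cases n) (simp_all add: genY_def)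
qed

text \<open>\<open>genX\<close> itself is not invariant: passing it costs a term in which the power
  drops from \<open>Suc n\<close> to \<open>n\<close>. The products \<open>genX * A\<close> and
  \<open>A * genX\<close> produce the same such term, so it cancels in the bracket.\<close>

lemma shuffle_X_invariant_commutator:
  assumes "shuffle_X_invariant A"
  shows "shuffle_X_invariant (commutator genX A)"
  unfolding shuffle_X_invariant_def
proof (intro allI)
  fix n v and F :: "'a letter list \<Rightarrow> 'b"
  have inv: "lin_ext (\<lambda>u. shuffle_X n F (u @ v)) A = shuffle_X n (\<lambda>v. lin_ext (\<lambda>u. F (u @ v)) A) v"
    for n v F using assms by (simp add: shuffle_X_invariant_def)
  have comm: "lin_ext G (commutator genX A) = lin_ext (\<lambda>u. G (X # u)) A - lin_ext (\<lambda>u. G (u @ [X])) A"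
    for G by (simp add: commutator_def lin_ext_diff genX_def lin_ext_mult_list)
  show "lin_ext (\<lambda>u. shuffle_X n F (u @ v)) (commutator genX A)
      = shuffle_X n (\<lambda>v. lin_ext (\<lambda>u. F (u @ v)) (commutator genX A)) v"
    by (cases n) (simp_all add: comm shuffle_X_diff lin_ext_fun_add inv)
qed

lemma shuffle_X_invariant_adY: "shuffle_X_invariant (adY k l)"
  unfolding adY_def
  by (induction k) (simp_all add: shuffle_X_invariant_genY shuffle_X_invariant_commutator)

lemma shuffle_X_invariant_prod_list:
  "(\<And>A. A \<in> set As \<Longrightarrow> shuffle_X_invariant A) \<Longrightarrow> shuffle_X_invariant (prod_list As)"
  by (induction As) (simp_all add: shuffle_X_invariant_one shuffle_X_invariant_mult)

section \<open>The recursion on the depth\<close>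

lemma pairing_shuffle_X:
  assumes "shuffle_X_invariant P" and "\<And>w. Poly_Mapping.lookup f (w @ [X]) = 0"
  shows "pairing (shuffle f (genX ^ n)) (P * genX ^ m) = of_bool (m = n) * pairing f P"
proof -
  let ?G = "\<lambda>v. lin_ext (\<lambda>u. Poly_Mapping.lookup f (u @ v)) P"
  have "pairing (shuffle f (genX ^ n)) (P * genX ^ m)
      = lin_ext (\<lambda>u. shuffle_X n (Poly_Mapping.lookup f) (u @ replicate m X)) P"
    by (simp add: pairing_lin_ext lookup_shuffle_X[abs_def] lin_ext_mult_list)
      (simp add: genX_power)
  also have "\<dots> = shuffle_X n ?G (replicate m X)"
    using assms(1) by (simp add: shuffle_X_invariant_def)
  also have "\<dots> = of_bool (m = n) * ?G []"
  proof (rule shuffle_X_delta)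
    fix j
    have "Poly_Mapping.lookup f (u @ replicate (Suc j) X) = 0" for u
      using assms(2)[of "u @ replicate j X"] by (simp flip: replicate_append_same)
    then show "?G (replicate (Suc j) X) = 0" by simp
  qed
  finally show ?thesis by (simp add: pairing_lin_ext)
qed

text \<open>In each bracket the words of the subtracted product end in \<open>X\<close> and are
  killed by \<open>F\<close>. The other product only prepends \<open>X\<close>, which preserves the
  hypothesis on \<open>F\<close>.\<close>

lemma lin_ext_adY:
  assumes "\<And>w. F (w @ [X]) = 0"
  shows "lin_ext F (adY k l) = F (replicate k X @ [Y l])"
  using assms
proof (induction k arbitrary: F)
  case 0
  show ?case by (simp add: adY_def genY_def)
next
  case (Suc k)
  have "lin_ext F (adY (Suc k) l)
      = lin_ext (\<lambda>u. F (X # u)) (adY k l) - lin_ext (\<lambda>u. F (u @ [X])) (adY k l)"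
    by (simp add: adY_def commutator_def lin_ext_diff genX_def lin_ext_mult_list)
  also have "\<dots> = F (replicate (Suc k) X @ [Y l])"
    using Suc.prems Suc.IH[of "\<lambda>u. F (X # u)"] Suc.prems[of "X # _"] by simp
  finally show ?case .
qed

lemma pairing_mult_genY_adY:
  "pairing (A * genY l) (P * adY k l') = of_bool (l = l') * pairing A (P * genX ^ k)"
proof -
  have vanish: "Poly_Mapping.lookup (A * genY l) (u @ w @ [X]) = 0" for u w
    using lookup_mult_genY(2)[of A l "u @ w" X] by simp
  have top: "Poly_Mapping.lookup (A * genY l) (u @ replicate k X @ [Y l'])
      = of_bool (l = l') * Poly_Mapping.lookup A (u @ replicate k X)" for u
    using lookup_mult_genY(2)[of A l "u @ replicate k X" "Y l'"] by auto
  show ?thesis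
    by (simp add: pairing_lin_ext lin_ext_mult_list lin_ext_adY vanish top lin_ext_fun_mult genX_power)
qed

lemma pairing_one_mult_adY: "pairing 1 (P * adY k l) = 0"
  by (simp add: pairing_lin_ext lin_ext_mult_list lin_ext_adY lookup_one_list)

abbreviation (input) adY_prod :: "(nat \<times> 'l) list \<Rightarrow> ('l, 'r::comm_ring_1) free_alg" where
  "adY_prod qs \<equiv> prod_list (map (\<lambda>(k, l). adY k l) qs)"

text \<open>Starting from 1 removes the special role of the first pair and of depth 0 in
  \<open>Spoly\<close>; \<open>shuffle_one_X\<close> reconciles the two forms.\<close>

abbreviation (input) shuffle_prod :: "(nat \<times> 'l) list \<Rightarrow> ('l, 'r::comm_ring_1) free_alg" where
  "shuffle_prod ps \<equiv> foldl (\<lambda>A (k, l). shuffle A (genX ^ k) * genY l) 1 ps"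

text \<open>Both sides are peeled from the right. The exponents of the last pairs become the
  trailing powers of \<open>X\<close>, so \<open>n\<close> and \<open>m\<close> must be general in
  the induction.\<close>

lemma pairing_shuffle_prod_adY_prod:
  "pairing (shuffle (shuffle_prod ps) (genX ^ n))
      (adY_prod qs * genX ^ m :: ('l, 'r::comm_ring_1) free_alg)
    = of_bool (ps = qs \<and> n = m)"
proof (induction ps arbitrary: qs n m rule: rev_induct)
  case Nil
  have "pairing 1 (adY_prod qs :: ('l, 'r) free_alg) = of_bool (qs = [])"
  proof (cases qs rule: rev_cases)
    case Nil
    then show ?thesis by (simp add: pairing_lin_ext lookup_one_list)
  next
    case (snoc qs' q)
    then show ?thesis by (cases q) (simp add: pairing_one_mult_adY)
  qed
  moreover have "shuffle_X_invariant (adY_prod qs :: ('l, 'r) free_alg)"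
    by (rule shuffle_X_invariant_prod_list) (auto simp: shuffle_X_invariant_adY)
  ultimately show ?case
    by (auto simp: pairing_shuffle_X lookup_one_list)
next
  case (snoc p ps)
  obtain k l where p: "p = (k, l)" by (cases p)
  let ?A = "shuffle (shuffle_prod ps) (genX ^ k) :: ('l, 'r) free_alg"
  have "pairing (?A * genY l) (adY_prod qs) = of_bool (ps @ [p] = qs)"
  proof (cases qs rule: rev_cases)
    case Nil
    then show ?thesis by (simp add: pairing_lin_ext lookup_mult_genY)
  next
    case (snoc qs' q)
    then show ?thesis
      using snoc.IH by (cases q) (auto simp: p pairing_mult_genY_adY)
  qed
  moreover have "shuffle_X_invariant (adY_prod qs :: ('l, 'r) free_alg)"
    by (rule shuffle_X_invariant_prod_list) (auto simp: shuffle_X_invariant_adY)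
  ultimately show ?case
    by (auto simp: p pairing_shuffle_X lookup_mult_genY)
qed

lemma Spoly_shuffle_prod: "Spoly t ls = shuffle (shuffle_prod (zip (fst t) ls)) (genX ^ snd t)"
  by (simp add: Spoly_def shuffle_one_X split: list.split)

theorem theorem3p2:
  fixes t k :: mindex and ls ms :: "'l list"
  assumes "length ls = dep t" and "length ms = dep k"
  shows "pairing (Spoly t ls) (Mpoly k ms :: ('l, 'r::{idom, ring_char_0}) free_alg) =
    (if (t, ls) = (k, ms) then 1 else 0)"
proof -
  \<comment> \<open>The length assumptions rule out truncation by \<open>zip\<close>, so both
    components can be recovered.\<close>
  have "zip (fst t) ls = zip (fst k) ms \<longleftrightarrow> fst t = fst k \<and> ls = ms"
    using assms by (metis dep_def map_fst_zip map_snd_zip)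
  then show ?thesis
    by (auto simp: Spoly_shuffle_prod Mpoly_def pairing_shuffle_prod_adY_prod prod_eq_iff)
qed

end
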